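(* Let $n\ge 2$ and let $\mathcal{P}_E^c(SD_{8n})$ be the conjugacy super enhanced power graph of the semidihedral group $SD_{8n}$. Put $\alpha=8n-1$, $\beta=6n-1$, $\gamma=4n-1$, $\delta=2n+1$. (i) If $n$ is odd, let $\psi=n$ and let $Q$ be the symmetric-pattern $6\times 6$ matrix \[\begin{bmatrix}0&\sqrt{\alpha^2+\beta^2}&(4n-2)\sqrt{\alpha^2+\gamma^2}&2n\sqrt{\alpha^2+\delta^2}&n\sqrt{\alpha^2+\psi^2}&n\sqrt{\alpha^2+\psi^2}\\ \sqrt{\alpha^2+\beta^2}&0&(4n-2)\sqrt{\beta^2+\gamma^2}&2n\sqrt{\beta^2+\delta^2}&0&0\\ \sqrt{\alpha^2+\gamma^2}&\sqrt{\beta^2+\gamma^2}&(4n-1)(4n-3)\sqrt2&0&0&0\\ \sqrt{\alpha^2+\delta^2}&\sqrt{\beta^2+\delta^2}&0&(2n-1)(2n+1)\sqrt2&0&0\\ \sqrt{\alpha^2+\psi^2}&0&0&0&n(n-1)\sqrt2&0\\ \sqrt{\alpha^2+\psi^2}&0&0&0&0&n(n-1)\sqrt2\end{bmatrix}.\] Then the Sombor spectrum of $\mathcal{P}_E^c(SD_{8n})$ consists of $-(2n+1)\sqrt2$ with multiplicity $2n-1$, $-(4n-1)\sqrt2$ with multiplicity $4n-3$, $-n\sqrt2$ with multiplicity $2n-2$, together with the eigenvalues (with multiplicity) of $Q$. (ii) If $n$ is even, let $\psi=2n$ and let $Q'$ be the $5\times5$ matrix \[\begin{bmatrix}0&\sqrt{\alpha^2+\beta^2}&(4n-2)\sqrt{\alpha^2+\gamma^2}&2n\sqrt{\alpha^2+\delta^2}&2n\sqrt{\alpha^2+\psi^2}\\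 \sqrt{\alpha^2+\beta^2}&0&(4n-2)\sqrt{\beta^2+\gamma^2}&2n\sqrt{\beta^2+\delta^2}&0\\ \sqrt{\alpha^2+\gamma^2}&\sqrt{\beta^2+\gamma^2}&(4n-1)(4n-3)\sqrt2&0&0\\ \sqrt{\alpha^2+\delta^2}&\sqrt{\beta^2+\delta^2}&0&(2n-1)(2n+1)\sqrt2&0\\ \sqrt{\alpha^2+\psi^2}&0&0&0&2n(2n-1)\sqrt2\end{bmatrix}.\] Then the Sombor spectrum of $\mathcal{P}_E^c(SD_{8n})$ consists of $-(4n-1)\sqrt2$ with multiplicity $4n-3$, $-(2n+1)\sqrt2$ with multiplicity $2n-1$, $-2n\sqrt2$ with multiplicity $2n-1$, together with the eigenvalues (with multiplicity) of $Q'$.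
   Context: For a finite simple graph $\Gamma$ with vertices $u_1,\dots,u_N$, the Sombor matrix $S(\Gamma)$ has $(i,j)$ entry $\sqrt{\deg(u_i)^2+\deg(u_j)^2}$ if $u_i,u_j$ are adjacent and $0$ otherwise; the Sombor spectrum is the multiset of its eigenvalues. $SD_{8n}=\langle a,b: a^{4n}=b^2=e,\ ba=a^{2n-1}b\rangle$ of order $8n$. The enhanced power graph $\mathcal{P}_E(G)$ has vertex set $G$, distinct vertices adjacent iff they lie in a common cyclic subgroup. The conjugacy super enhanced power graph $\mathcal{P}_E^c(G)$ has vertex set $G$, and distinct $g,h$ are adjacent iff $g,h$ are conjugate or there exist $g'$ conjugate to $g$ and $h'$ conjugate to $h$ adjacent in $\mathcal{P}_E(G)$. *)

theory Defs
  imports "HOL-Algebra.Group" "HOL-Algebra.Generated_Groups"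
    "Jordan_Normal_Form.Char_Poly" "HOL-Library.Product_Lexorder"
    "HOL-Computational_Algebra.Polynomial"
begin

text \<open>Element (i,j) with i < 4n, j < 2 represents a^i b^j.
  Since b a = a^(2n-1) b, we get b^j a^k = a^((2n-1)^j k) b^j.\<close>

definition sd_mult :: "nat \<Rightarrow> nat \<times> nat \<Rightarrow> nat \<times> nat \<Rightarrow> nat \<times> nat" where
  "sd_mult n x y = ((fst x + (2*n - 1) ^ snd x * fst y) mod (4*n), (snd x + snd y) mod 2)"

definition SD :: "nat \<Rightarrow> (nat \<times> nat) monoid" where
  "SD n = \<lparr>carrier = {0..<4*n} \<times> {0..<2}, monoid.mult = sd_mult n, one = (0, 0)\<rparr>"

definition enh_adj :: "('a, 'b) monoid_scheme \<Rightarrow> 'a \<Rightarrow> 'a \<Rightarrow> bool" where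
  "enh_adj G x y \<longleftrightarrow> x \<in> carrier G \<and> y \<in> carrier G \<and> x \<noteq> y \<and>
     (\<exists>z \<in> carrier G. x \<in> generate G {z} \<and> y \<in> generate G {z})"

definition conjugate :: "('a, 'b) monoid_scheme \<Rightarrow> 'a \<Rightarrow> 'a \<Rightarrow> bool" where
  "conjugate G x y \<longleftrightarrow> x \<in> carrier G \<and> y \<in> carrier G \<and>
     (\<exists>g \<in> carrier G. y = g \<otimes>\<^bsub>G\<^esub> x \<otimes>\<^bsub>G\<^esub> inv\<^bsub>G\<^esub> g)"

definition conj_super_enh_adj :: "('a, 'b) monoid_scheme \<Rightarrow> 'a \<Rightarrow> 'a \<Rightarrow> bool" where
  "conj_super_enh_adj G x y \<longleftrightarrow> x \<in> carrier G \<and> y \<in> carrier G \<and> x \<noteq> y \<and>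
     (conjugate G x y \<or>
      (\<exists>x' y'. conjugate G x x' \<and> conjugate G y y' \<and> enh_adj G x' y'))"

definition graph_deg :: "'a set \<Rightarrow> ('a \<Rightarrow> 'a \<Rightarrow> bool) \<Rightarrow> 'a \<Rightarrow> nat" where
  "graph_deg V E v = card {u \<in> V. E v u}"

text \<open>Vertices are listed in increasing order; the spectrum does not depend on the order.\<close>
definition sombor_matrix :: "'a::linorder set \<Rightarrow> ('a \<Rightarrow> 'a \<Rightarrow> bool) \<Rightarrow> real mat" where
  "sombor_matrix V E = (let vs = sorted_list_of_set V; N = length vs in
     mat N N (\<lambda>(i, j). if E (vs ! i) (vs ! j)
        then sqrt (real (graph_deg V E (vs ! i)) ^ 2 + real (graph_deg V E (vs ! j)) ^ 2)
        else 0))"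

definition mat_spectrum :: "real mat \<Rightarrow> complex multiset" where
  "mat_spectrum A = proots (char_poly (map_mat complex_of_real A))"

definition sombor_spectrum :: "'a::linorder set \<Rightarrow> ('a \<Rightarrow> 'a \<Rightarrow> bool) \<Rightarrow> complex multiset" where
  "sombor_spectrum V E = mat_spectrum (sombor_matrix V E)"

definition Q_odd :: "nat \<Rightarrow> real mat" where
  "Q_odd n = (let m = real n; \<alpha> = 8*m - 1; \<beta> = 6*m - 1; \<gamma> = 4*m - 1; \<delta> = 2*m + 1; \<psi> = m in
    mat_of_rows_list 6
     [[0, sqrt (\<alpha>^2+\<beta>^2), (4*m-2) * sqrt (\<alpha>^2+\<gamma>^2), 2*m * sqrt (\<alpha>^2+\<delta>^2),
         m * sqrt (\<alpha>^2+\<psi>^2), m * sqrt (\<alpha>^2+\<psi>^2)],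
      [sqrt (\<alpha>^2+\<beta>^2), 0, (4*m-2) * sqrt (\<beta>^2+\<gamma>^2), 2*m * sqrt (\<beta>^2+\<delta>^2), 0, 0],
      [sqrt (\<alpha>^2+\<gamma>^2), sqrt (\<beta>^2+\<gamma>^2), (4*m-1)*(4*m-3) * sqrt 2, 0, 0, 0],
      [sqrt (\<alpha>^2+\<delta>^2), sqrt (\<beta>^2+\<delta>^2), 0, (2*m-1)*(2*m+1) * sqrt 2, 0, 0],
      [sqrt (\<alpha>^2+\<psi>^2), 0, 0, 0, m*(m-1) * sqrt 2, 0],
      [sqrt (\<alpha>^2+\<psi>^2), 0, 0, 0, 0, m*(m-1) * sqrt 2]])"

definition Q_even :: "nat \<Rightarrow> real mat" where
  "Q_even n = (let m = real n; \<alpha> = 8*m - 1; \<beta> = 6*m - 1; \<gamma> = 4*m - 1; \<delta> = 2*m + 1; \<psi> = 2*m in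
    mat_of_rows_list 5
     [[0, sqrt (\<alpha>^2+\<beta>^2), (4*m-2) * sqrt (\<alpha>^2+\<gamma>^2), 2*m * sqrt (\<alpha>^2+\<delta>^2),
         2*m * sqrt (\<alpha>^2+\<psi>^2)],
      [sqrt (\<alpha>^2+\<beta>^2), 0, (4*m-2) * sqrt (\<beta>^2+\<gamma>^2), 2*m * sqrt (\<beta>^2+\<delta>^2), 0],
      [sqrt (\<alpha>^2+\<gamma>^2), sqrt (\<beta>^2+\<gamma>^2), (4*m-1)*(4*m-3) * sqrt 2, 0, 0],
      [sqrt (\<alpha>^2+\<delta>^2), sqrt (\<beta>^2+\<delta>^2), 0, (2*m-1)*(2*m+1) * sqrt 2, 0],
      [sqrt (\<alpha>^2+\<psi>^2), 0, 0, 0, 2*m*(2*m-1) * sqrt 2]])"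

end

theory Submission
  imports Defs "HOL-Number_Theory.Cong"
begin

text \<open>
  Up to equality of vertices, adjacency in the conjugacy super enhanced power graph depends only on
  the classes of the two vertices in the partition into the identity, the central involution
  \<open>a^(2n)\<close>, the other rotations, the elements \<open>a^i b\<close> with i odd (whose square is \<open>a^(2n)\<close>), and the
  conjugacy classes of the involutions \<open>a^i b\<close> with i even. Each class is a clique of vertices of
  the same degree d, so the Sombor matrix is constant on the blocks of the partition, except for
  its zero diagonal. A Sylvester-type determinant identity then splits the characteristic
  polynomial into the factors \<open>(x + d sqrt 2)^(m - 1)\<close>, one for each class of size m, and the
  characteristic polynomial of the quotient matrix.
\<close>

section \<open>Spectra of matrices that are constant on the blocks of a partition\<close>

lemma det_diff_mult_intertwined:
  fixes L :: "'a :: idom mat"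
  assumes L: "L \<in> carrier_mat N N" and L': "L' \<in> carrier_mat k k"
    and C: "C \<in> carrier_mat N k" and Y: "Y \<in> carrier_mat k N"
    and LC: "L * C = C * L'"
  shows "det (L - C * Y) * det L' = det L * det (L' - Y * C)"
  \<comment> \<open>Two block triangular factorisations of the matrix with rows (L, C L') and (Y, L').\<close>
proof -
  have CY: "C * Y \<in> carrier_mat N N" and YC: "Y * C \<in> carrier_mat k k"
    and LC': "C * L' \<in> carrier_mat N k"
    using C Y L' by auto
  have 1: "four_block_mat (1\<^sub>m N) C (0\<^sub>m k N) (1\<^sub>m k) * four_block_mat (L - C * Y) (0\<^sub>m N k) Y L'
      = four_block_mat L (C * L') Y L'"
  proof (subst mult_four_block_mat)
    show "four_block_mat (1\<^sub>m N * (L - C * Y) + C * Y) (1\<^sub>m N * 0\<^sub>m N k + C * L')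
        (0\<^sub>m k N * (L - C * Y) + 1\<^sub>m k * Y) (0\<^sub>m k N * 0\<^sub>m N k + 1\<^sub>m k * L')
      = four_block_mat L (C * L') Y L'"
      using L L' C Y CY LC' by (intro arg_cong4[of _ _ _ _ _ _ _ _ four_block_mat] eq_matI) auto
  qed (use L L' C Y CY in auto)
  have 2: "four_block_mat L (0\<^sub>m N k) Y (L' - Y * C) * four_block_mat (1\<^sub>m N) C (0\<^sub>m k N) (1\<^sub>m k)
      = four_block_mat L (C * L') Y L'"
  proof (subst mult_four_block_mat)
    show "four_block_mat (L * 1\<^sub>m N + 0\<^sub>m N k * 0\<^sub>m k N) (L * C + 0\<^sub>m N k * 1\<^sub>m k)
        (Y * 1\<^sub>m N + (L' - Y * C) * 0\<^sub>m k N) (Y * C + (L' - Y * C) * 1\<^sub>m k)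
      = four_block_mat L (C * L') Y L'"
      using L L' C Y YC LC' unfolding LC
      by (intro arg_cong4[of _ _ _ _ _ _ _ _ four_block_mat] eq_matI) auto
  qed (use L L' C Y YC in auto)
  \<comment> \<open>The outer factor is unitriangular, so comparing the two factorisations involves
    no inverse of \<open>L\<close> or \<open>L'\<close>.\<close>
  have U: "det (four_block_mat (1\<^sub>m N) C (0\<^sub>m k N) (1\<^sub>m k)) = 1"
    using C by (subst det_four_block_mat_lower_left_zero[of _ N _ k]) auto
  have "det (four_block_mat (L - C * Y) (0\<^sub>m N k) Y L') = det (L - C * Y) * det L'"
    using L L' Y CY by (intro det_four_block_mat_upper_right_zero[of _ N _ k] minus_carrier_mat) auto
  moreover have "det (four_block_mat L (0\<^sub>m N k) Y (L' - Y * C)) = det L * det (L' - Y * C)"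
    using L L' Y YC by (intro det_four_block_mat_upper_right_zero[of _ N _ k] minus_carrier_mat) auto
  moreover have "det (four_block_mat (L - C * Y) (0\<^sub>m N k) Y L') = det (four_block_mat L (C * L') Y L')"
    unfolding 1[symmetric]
    using L L' C Y CY U by (subst det_mult[of _ "N + k"]) auto
  moreover have "det (four_block_mat L (0\<^sub>m N k) Y (L' - Y * C)) = det (four_block_mat L (C * L') Y L')"
    unfolding 2[symmetric]
    using L L' C Y YC U by (subst det_mult[of _ "N + k"]) auto
  ultimately show ?thesis by simp
qed

lemma det_mat_diag:
  "det (mat n n (\<lambda>(i, j). if i = j then f i else 0)) = (\<Prod>i<n. f i :: 'a :: comm_ring_1)"
  by (subst det_upper_triangular[of _ n])
     (auto simp: prod_list_diag_prod atLeast0LessThan upper_triangular_def)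

lemma char_poly_equitable:
  fixes B :: "nat \<Rightarrow> nat \<Rightarrow> 'a :: idom"
  assumes c: "\<And>i. i < N \<Longrightarrow> c i < k"
    and m: "\<And>p. p < k \<Longrightarrow> m p = card {i. i < N \<and> c i = p}"
    and m_pos: "\<And>p. p < k \<Longrightarrow> m p > 0"
  shows "char_poly (mat N N (\<lambda>(i, j). if i = j then 0 else B (c i) (c j))) =
     (\<Prod>p<k. [: B p p, 1 :] ^ (m p - 1)) *
     char_poly (mat k k (\<lambda>(p, q). of_nat (m q) * B p q - (if p = q then B p p else 0)))"
    (is "char_poly ?M = _ * char_poly ?Q")
proof -
  \<comment> \<open>C is the incidence matrix of the partition c, and the characteristic matrix is L - C Y
    with L diagonal and constant on the classes.\<close>
  define l where "l p = [: B p p, 1 :]" for p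
  define L where "L = mat N N (\<lambda>(i, j). if i = j then l (c i) else 0)"
  define L' where "L' = mat k k (\<lambda>(i, j). if i = j then l i else 0)"
  define C where "C = mat N k (\<lambda>(i, p). if c i = p then 1 else 0 :: 'a poly)"
  define Y where "Y = mat k N (\<lambda>(p, j). [: B p (c j) :])"
  note defs = L_def L'_def C_def Y_def l_def
  have CY: "C * Y = mat N N (\<lambda>(i, j). [: B (c i) (c j) :])"
    by (rule eq_matI) (auto simp: defs scalar_prod_def if_distrib[of "Polynomial.smult _"] c cong: if_cong)
  have card_sum: "(\<Sum>i = 0..<N. if c i = q then x else 0) = of_nat (m q) * x" if "q < k" for q and x :: "'a poly"
    using m[OF that] by (simp add: sum.If_cases Int_def)
  have YC: "Y * C = mat k k (\<lambda>(p, q). of_nat (m q) * [: B p q :])"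
  proof (rule eq_matI, goal_cases)
    case (1 p q)
    then have "(Y * C) $$ (p, q) = (\<Sum>i = 0..<N. if c i = q then [: B p q :] else 0)"
      by (auto simp: defs scalar_prod_def intro!: sum.cong)
    then show ?case using 1 by (simp add: card_sum)
  qed (auto simp: defs)
  \<comment> \<open>\<open>L\<close> and \<open>L'\<close> carry the same polynomial on each class,
    which is what makes \<open>C\<close> intertwine them.\<close>
  have "L * C = mat N k (\<lambda>(i, p). if c i = p then l p else 0)"
    by (rule eq_matI) (auto simp: defs scalar_prod_def if_distrib[of "\<lambda>x. x * _"] cong: if_cong)
  also have "\<dots> = C * L'"
    by (rule eq_matI) (auto simp: defs scalar_prod_def if_distrib[of "\<lambda>x. x * _"] c cong: if_cong)
  finally have LC: "L * C = C * L'" .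
  have M: "char_poly_matrix ?M = L - C * Y"
    unfolding CY by (rule eq_matI) (auto simp: defs char_poly_matrix_def)
  have Q: "char_poly_matrix ?Q = L' - Y * C"
    unfolding YC by (rule eq_matI) (auto simp: defs char_poly_matrix_def of_nat_poly)
  have *: "char_poly ?M * det L' = det L * char_poly ?Q"
    unfolding char_poly_def M Q
    by (rule det_diff_mult_intertwined[OF _ _ _ _ LC]) (auto simp: defs)
  have L'_prod: "det L' = (\<Prod>p<k. l p)"
    unfolding L'_def by (rule det_mat_diag)
  have "det L = (\<Prod>i<N. l (c i))"
    unfolding L_def by (rule det_mat_diag)
  also have "\<dots> = (\<Prod>p<k. \<Prod>i\<in>{i\<in>{..<N}. c i = p}. l (c i))"
    using c by (intro prod.group[symmetric]) auto
  also have "\<dots> = (\<Prod>p<k. l p ^ m p)"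
    using m by (intro prod.cong) (auto simp: conj_commute)
  \<comment> \<open>One factor per class is split off to match \<open>det L'\<close>;
    \<open>m_pos\<close> keeps the truncated exponent \<open>m p - 1\<close> exact.\<close>
  also have "\<dots> = (\<Prod>p<k. l p * l p ^ (m p - 1))"
    using m_pos by (intro prod.cong) (auto simp flip: power_Suc)
  finally have L_prod: "det L = (\<Prod>p<k. l p) * (\<Prod>p<k. l p ^ (m p - 1))"
    by (simp add: prod.distrib)
  \<comment> \<open>Each \<open>l p\<close> is monic of degree 1, so the product can be cancelled in
    the domain of polynomials.\<close>
  have "(\<Prod>p<k. l p) \<noteq> 0" by (simp add: l_def)
  moreover have "(\<Prod>p<k. l p) * char_poly ?M = (\<Prod>p<k. l p) * ((\<Prod>p<k. l p ^ (m p - 1)) * char_poly ?Q)"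
    using * by (simp add: L_prod L'_prod ac_simps)
  ultimately show ?thesis unfolding l_def[symmetric] by (rule iffD1[OF mult_left_cancel])
qed

section \<open>Graphs whose adjacency depends only on the classes of a partition\<close>

text \<open>Reflexivity of \<open>R\<close> puts \<open>v\<close> among the vertices of related
  classes, so these form its closed neighbourhood; removing \<open>v\<close> accounts for the
  \<open>- 1\<close>.\<close>

lemma graph_deg_equitable:
  fixes c :: "'a \<Rightarrow> nat"
  assumes "finite V" and "v \<in> V"
    and c: "\<And>v. v \<in> V \<Longrightarrow> c v < k"
    and E: "\<And>u v. u \<in> V \<Longrightarrow> v \<in> V \<Longrightarrow> E u v \<longleftrightarrow> u \<noteq> v \<and> R (c u) (c v)"
    and refl: "\<And>p. p < k \<Longrightarrow> R p p"
  shows "graph_deg V E v = (\<Sum>q<k. if R (c v) q then card {u \<in> V. c u = q} else 0) - 1"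
proof -
  have "{u \<in> V. E v u} = {u \<in> V. R (c v) (c u)} - {v}"
    using E \<open>v \<in> V\<close> by auto
  then have "graph_deg V E v = card {u \<in> V. R (c v) (c u)} - 1"
    using c refl \<open>v \<in> V\<close> \<open>finite V\<close> by (simp add: graph_deg_def)
  also have "card {u \<in> V. R (c v) (c u)} = (\<Sum>u\<in>V. if R (c v) (c u) then 1 else 0)"
    using \<open>finite V\<close> by (simp add: sum.If_cases Int_def)
  also have "\<dots> = (\<Sum>q<k. \<Sum>u\<in>{u \<in> V. c u = q}. if R (c v) (c u) then 1 else 0)"
    using c \<open>finite V\<close> by (intro sum.group[symmetric]) auto
  also have "\<dots> = (\<Sum>q<k. if R (c v) q then card {u \<in> V. c u = q} else 0)"
    by (intro sum.cong) auto
  finally show ?thesis .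
qed

text \<open>Degrees, hence Sombor entries, depend only on classes, so
  \<open>char_poly_equitable\<close> applies once vertices are replaced by their positions in the
  sorted list. Inside a class the entry is \<open>d p * sqrt 2\<close>, and its negative is the
  repeated eigenvalue.\<close>

lemma sombor_spectrum_equitable:
  fixes V :: "'a :: linorder set"
  assumes "finite V"
    and c: "\<And>v. v \<in> V \<Longrightarrow> c v < k"
    and m: "\<And>p. p < k \<Longrightarrow> card {v \<in> V. c v = p} = m p"
    and m_pos: "\<And>p. p < k \<Longrightarrow> m p > 0"
    and E: "\<And>u v. u \<in> V \<Longrightarrow> v \<in> V \<Longrightarrow> E u v \<longleftrightarrow> u \<noteq> v \<and> R (c u) (c v)"
    and refl: "\<And>p. p < k \<Longrightarrow> R p p"
    and d: "\<And>p. p < k \<Longrightarrow> d p = real ((\<Sum>q<k. if R p q then m q else 0) - 1)"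
  shows "sombor_spectrum V E =
    (\<Sum>p<k. replicate_mset (m p - 1) (complex_of_real (- d p * sqrt 2))) +
    mat_spectrum (mat k k (\<lambda>(p, q). real (m q) * (if R p q then sqrt (d p ^ 2 + d q ^ 2) else 0)
        - (if p = q then d p * sqrt 2 else 0)))"
proof -
  define vs where "vs = sorted_list_of_set V"
  define N where "N = length vs"
  have vs: "set vs = V" "distinct vs"
    using \<open>finite V\<close> by (auto simp: vs_def)
  then have vs_mem: "vs ! i \<in> V" if "i < N" for i
    using that by (auto simp: N_def)
  define s where "s p q = (if R p q then sqrt (d p ^ 2 + d q ^ 2) else 0)" for p q
  define B where "B p q = complex_of_real (s p q)" for p q
  have deg: "real (graph_deg V E v) = d (c v)" if "v \<in> V" for v
    using graph_deg_equitable[OF \<open>finite V\<close> that c E refl] d[OF c[OF that]] m c[OF that]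
    by (simp cong: if_cong)
  have d_nonneg: "d p \<ge> 0" if "p < k" for p
    using d[OF that] by simp
  have diag: "s p p = d p * sqrt 2" if "p < k" for p
    using refl[OF that] d_nonneg[OF that] by (simp add: s_def real_sqrt_mult flip: mult_2)
  have fibre: "m p = card {i. i < N \<and> c (vs ! i) = p}" if "p < k" for p
  proof -
    have "bij_betw ((!) vs) {i. i < N \<and> c (vs ! i) = p} {v \<in> V. c v = p}"
      using vs by (auto simp: bij_betw_def inj_on_def nth_eq_iff_index_eq N_def in_set_conv_nth)
    then show ?thesis using m[OF that] by (simp add: bij_betw_same_card)
  qed
  have M: "map_mat complex_of_real (sombor_matrix V E) =
      mat N N (\<lambda>(i, j). if i = j then 0 else B (c (vs ! i)) (c (vs ! j)))"
    unfolding sombor_matrix_def Let_def vs_def[symmetric] N_def[symmetric]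
    using vs by (intro eq_matI) (auto simp: vs_mem E deg B_def s_def nth_eq_iff_index_eq N_def[symmetric])
  have Q: "map_mat complex_of_real (mat k k (\<lambda>(p, q). real (m q) * (if R p q then sqrt (d p ^ 2 + d q ^ 2) else 0)
        - (if p = q then d p * sqrt 2 else 0)))
      = mat k k (\<lambda>(p, q). of_nat (m q) * B p q - (if p = q then B p p else 0))"
    unfolding s_def[symmetric] by (intro eq_matI) (auto simp: diag B_def)
  \<comment> \<open>Multisets of roots add over products of nonzero polynomials; a characteristic
    polynomial is monic.\<close>
  have ne: "char_poly (mat k k (\<lambda>(p, q). of_nat (m q) * B p q - (if p = q then B p p else 0))) \<noteq> 0"
    (is "char_poly ?Q \<noteq> 0")
    using degree_monic_char_poly[of ?Q k] by auto
  have "sombor_spectrum V E = proots ((\<Prod>p<k. [: B p p, 1 :] ^ (m p - 1)) *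
     char_poly (mat k k (\<lambda>(p, q). of_nat (m q) * B p q - (if p = q then B p p else 0))))"
    unfolding sombor_spectrum_def mat_spectrum_def M
    using c vs_mem fibre m_pos by (subst char_poly_equitable[where m = m and k = k]) auto
  also have "\<dots> = (\<Sum>p<k. repeat_mset (m p - 1) {#- B p p#}) +
     mat_spectrum (mat k k (\<lambda>(p, q). real (m q) * (if R p q then sqrt (d p ^ 2 + d q ^ 2) else 0)
        - (if p = q then d p * sqrt 2 else 0)))"
    unfolding mat_spectrum_def Q using ne
    by (subst proots_mult) (auto simp: proots_prod proots_power)
  also have "(\<Sum>p<k. repeat_mset (m p - 1) {#- B p p#}) =
      (\<Sum>p<k. replicate_mset (m p - 1) (complex_of_real (- d p * sqrt 2)))"
    by (intro sum.cong) (auto simp: diag B_def)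
  finally show ?thesis .
qed

section \<open>The semidihedral group\<close>

lemma carrier_SD: "carrier (SD n) = {0..<4*n} \<times> {0..<2}"
  and one_SD: "\<one>\<^bsub>SD n\<^esub> = (0, 0)"
  and mult_SD: "(i, p) \<otimes>\<^bsub>SD n\<^esub> (j, q) = ((i + (2*n - 1) ^ p * j) mod (4*n), (p + q) mod 2)"
  by (simp_all add: SD_def sd_mult_def)

text \<open>\<open>(2n - 1)^2 = 4n(n - 1) + 1\<close>, in keeping with \<open>b^2 = e\<close> acting
  trivially on the rotations.\<close>

lemma SD_twist_square:
  fixes n :: nat
  shows "n > 0 \<Longrightarrow> [(2*n - 1) ^ 2 = 1] (mod (4*n))"
proof (cases n)
  case (Suc k)
  then have "(2*n - 1) ^ 2 = 4*n*k + 1" by (simp add: power2_eq_square algebra_simps)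
  moreover have "[4*n*k + 1 = 0 + 1] (mod (4*n))" by (intro cong_add) (auto simp: cong_def)
  ultimately show ?thesis by simp
qed simp

text \<open>Since the twist squares to 1, only the parity of the exponent of \<open>b\<close>
  matters; associativity of \<open>sd_mult\<close> rests on this.\<close>

lemma SD_twist_power_mod_2:
  fixes n :: nat
  assumes "n > 0" shows "[(2*n - 1) ^ (p mod 2) = (2*n - 1) ^ p] (mod (4*n))"
proof -
  have "(2*n - 1) ^ p = ((2*n - 1) ^ 2) ^ (p div 2) * (2*n - 1) ^ (p mod 2)"
    by (simp flip: power_mult power_add)
  moreover have "[((2*n - 1) ^ 2) ^ (p div 2) * (2*n - 1) ^ (p mod 2)
      = 1 ^ (p div 2) * (2*n - 1) ^ (p mod 2)] (mod (4*n))"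
    by (intro cong_mult cong_pow SD_twist_square assms cong_refl)
  ultimately show ?thesis by (simp add: cong_sym)
qed

lemma group_SD:
  assumes "n > 0" shows "group (SD n)"
proof (rule groupI, goal_cases)
  case (1 x y)
  then show ?case using assms by (cases x; cases y) (simp add: carrier_SD mult_SD)
next
  case (3 x y z)
  obtain i p j q k r where xyz: "x = (i, p)" "y = (j, q)" "z = (k, r)" by (metis surj_pair)
  have "[(i + (2*n-1)^p * j) mod (4*n) + (2*n-1)^((p+q) mod 2) * k
      = (i + (2*n-1)^p * j) + (2*n-1)^(p+q) * k] (mod 4*n)"
    by (intro cong_add cong_mult SD_twist_power_mod_2 assms cong_refl) (simp add: cong_def)
  also have "(i + (2*n-1)^p * j) + (2*n-1)^(p+q) * k = i + (2*n-1)^p * (j + (2*n-1)^q * k)"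
    by (simp add: algebra_simps power_add)
  also have "[\<dots> = i + (2*n-1)^p * ((j + (2*n-1)^q * k) mod (4*n))] (mod 4*n)"
    by (intro cong_add cong_mult cong_refl) (simp add: cong_def)
  finally show ?case
    by (simp add: xyz mult_SD cong_def mod_simps add.assoc)
next
  case (5 x)
  then obtain i p where x: "x = (i, p)" "i < 4*n" "p < 2" by (auto simp: carrier_SD)
  \<comment> \<open>The left inverse is \<open>b^(-p) a^(-i)\<close> brought into normal form, with
    \<open>b^(-p) = b^p\<close>.\<close>
  have "((2*n-1)^p * (4*n - i) mod (4*n) + (2*n-1)^p * i) mod (4*n) = (2*n-1)^p * (4*n - i + i) mod (4*n)"
    unfolding distrib_left by (simp add: mod_simps)
  also have "\<dots> = 0" using x by simp
  finally have "((2*n-1)^p * (4*n - i) mod (4*n), p) \<otimes>\<^bsub>SD n\<^esub> x = \<one>\<^bsub>SD n\<^esub>"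
    using x by (auto simp: mult_SD one_SD)
  moreover have "((2*n-1)^p * (4*n - i) mod (4*n), p) \<in> carrier (SD n)"
    using x assms by (simp add: carrier_SD)
  ultimately show ?case by blast
qed (use assms in \<open>auto simp: carrier_SD one_SD mult_SD\<close>)

section \<open>Conjugacy and adjacency in an arbitrary group\<close>

text \<open>Multiplying by \<open>g\<close> on the right removes the inverse, so conjugacy in
  \<open>SD n\<close> can be read off from the multiplication formula alone.\<close>

lemma (in group) conjugate_iff:
  "conjugate G x y \<longleftrightarrow> x \<in> carrier G \<and> y \<in> carrier G \<and> (\<exists>g\<in>carrier G. y \<otimes> g = g \<otimes> x)"
proof -
  have "y = g \<otimes> x \<otimes> inv g \<longleftrightarrow> y \<otimes> g = g \<otimes> x"
    if "x \<in> carrier G" "y \<in> carrier G" "g \<in> carrier G" for g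
    using that by (metis inv_solve_right m_closed)
  then show ?thesis unfolding conjugate_def by blast
qed

lemma (in group) conjugate_refl: "x \<in> carrier G \<Longrightarrow> conjugate G x x"
  unfolding conjugate_iff by (auto intro!: bexI[of _ \<one>])

lemma (in group) conjugate_sym: "conjugate G x y \<Longrightarrow> conjugate G y x"
  unfolding conjugate_def
proof (elim conjE bexE, intro conjI)
  fix g assume *: "x \<in> carrier G" "g \<in> carrier G" "y = g \<otimes> x \<otimes> inv g"
  then have "x = inv g \<otimes> y \<otimes> inv (inv g)"
    by (simp add: m_assoc) (simp flip: m_assoc)
  then show "\<exists>g\<in>carrier G. x = g \<otimes> y \<otimes> inv g" using * by blast
qed

lemma enh_adj_sym: "enh_adj G x y \<Longrightarrow> enh_adj G y x"
  unfolding enh_adj_def by auto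

lemma (in group) conj_super_enh_adj_sym: "conj_super_enh_adj G x y \<Longrightarrow> conj_super_enh_adj G y x"
  unfolding conj_super_enh_adj_def by (metis conjugate_sym enh_adj_sym)

lemma (in group) enh_adj_imp_conj_super_enh_adj: "enh_adj G x y \<Longrightarrow> conj_super_enh_adj G x y"
  unfolding conj_super_enh_adj_def by (metis conjugate_refl enh_adj_def)

text \<open>Bounds cyclic subgroups from above. \<open>generate\<close> inverts only the generator
  itself, so the inverse of \<open>z\<close> is the only one to check.\<close>

lemma generate_subset_of_closed:
  assumes "\<one>\<^bsub>G\<^esub> \<in> H" "z \<in> H" "inv\<^bsub>G\<^esub> z \<in> H"
    and "\<And>x y. x \<in> H \<Longrightarrow> y \<in> H \<Longrightarrow> x \<otimes>\<^bsub>G\<^esub> y \<in> H"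
  shows "generate G {z} \<subseteq> H"
proof
  fix x assume "x \<in> generate G {z}"
  then show "x \<in> H" by induction (use assms in auto)
qed

section \<open>Conjugacy in the semidihedral group and the classes of vertices\<close>

text \<open>With \<open>g = a^t b^r\<close>, compare normal forms in \<open>y g = g x\<close>: the
  exponents of \<open>b\<close> force \<open>q = p\<close>, those of \<open>a\<close> give the
  congruence.\<close>

lemma conjugate_SD_iff:
  assumes "n > 0"
  shows "conjugate (SD n) (i, p) (j, q) \<longleftrightarrow> i < 4*n \<and> p < 2 \<and> j < 4*n \<and> q = p \<and>
    (\<exists>t<4*n. \<exists>r<2. [t + (2*n-1)^r * i = j + (2*n-1)^p * t] (mod (4*n)))"
proof -
  interpret group "SD n" using assms by (rule group_SD)
  have "(j, q) \<otimes>\<^bsub>SD n\<^esub> (t, r) = (t, r) \<otimes>\<^bsub>SD n\<^esub> (i, p) \<longleftrightarrow>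
      q = p \<and> [t + (2*n-1)^r * i = j + (2*n-1)^p * t] (mod (4*n))" if "p < 2" "q < 2" for t r
  proof -
    have "(q + r) mod 2 = (r + p) mod 2 \<longleftrightarrow> q = p"
      using that by (auto simp: less_2_cases_iff) presburger+
    then show ?thesis by (auto simp: mult_SD cong_def)
  qed
  then show ?thesis
    unfolding conjugate_iff Bex_def split_paired_Ex by (auto simp: carrier_SD)
qed

text \<open>Class 0 is the identity, 1 is \<open>a^(2n)\<close>, 2 the remaining rotations, 3 the \<open>a^i b\<close> with i odd.
  The \<open>a^i b\<close> with i even form one conjugacy class (4) if n is even and two (4 and 5) if n is odd.\<close>

definition sd_class :: "nat \<Rightarrow> nat \<times> nat \<Rightarrow> nat" where
  "sd_class n x =
    (if snd x = 0 then (if fst x = 0 then 0 else if fst x = 2*n then 1 else 2)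
     else if odd (fst x) then 3
     else if odd n \<and> fst x mod 4 = 2 then 5 else 4)"

text \<open>The quotient graph, with a loop at each class because classes are cliques. Class 1 is
  joined to class 3 because the elements of class 3 square to \<open>a^(2n)\<close>.\<close>

definition sd_class_adj :: "nat \<Rightarrow> nat \<Rightarrow> bool" where
  "sd_class_adj p q \<longleftrightarrow> p = q \<or> p = 0 \<or> q = 0 \<or> p = 1 \<and> q \<in> {2, 3} \<or> q = 1 \<and> p \<in> {2, 3}"

text \<open>Even multiples of \<open>2n\<close> vanish modulo \<open>4n\<close>. With
  \<open>k\<close> a power of the twist this makes \<open>a^(2n)\<close> central; with
  \<open>k = i\<close> it evaluates the square of \<open>a^i b\<close>.\<close>

lemma odd_mult_half_cong:
  fixes k n :: nat
  shows "odd k \<Longrightarrow> (k * (2*n)) mod (4*n) = 2*n mod (4*n)"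
  by (elim oddE) (simp add: algebra_simps)

text \<open>The twist is odd, so it fixes the exponents 0 and \<open>2n\<close> modulo
  \<open>4n\<close>: \<open>e\<close> and \<open>a^(2n)\<close> are central.\<close>

lemma conjugate_SD_rotation_fixed:
  assumes "n > 0" "conjugate (SD n) (i, 0) (j, q)" "i = 0 \<or> i = 2*n"
  shows "j = i"
proof -
  obtain t r where "[t + (2*n-1)^r * i = j + t] (mod (4*n))" and j: "j < 4*n" and i: "i < 4*n"
    using assms by (auto simp: conjugate_SD_iff)
  then have "[(2*n-1)^r * i = j] (mod (4*n))"
    by (simp add: add.commute[of t] cong_add_rcancel_nat)
  moreover have "[(2*n-1)^r * i = i] (mod (4*n))"
    using odd_mult_half_cong[of "(2*n-1)^r" n] assms by (auto simp: cong_def)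
  ultimately show "j = i" using i j by (simp add: cong_def)
qed

lemma conjugate_SD_reflection_iff:
  assumes "n > 0"
  shows "conjugate (SD n) (i, 1) (j, 1) \<longleftrightarrow>
    i < 4*n \<and> j < 4*n \<and> [i = j] (mod (if odd n then 4 else 2))"
proof
  assume "conjugate (SD n) (i, 1) (j, 1)"
  then obtain t r where *: "[t + (2*n-1)^r * i = j + (2*n-1) * t] (mod (4*n))" and ij: "j < 4*n" "i < 4*n"
    using assms by (auto simp: conjugate_SD_iff)
  define d :: nat where "d = (if odd n then 4 else 2)"
  \<comment> \<open>Modulo \<open>d\<close> the twist is 1: for odd \<open>n\<close> because
    \<open>2n\<close> is 2 modulo 4, for even \<open>n\<close> by parity. As \<open>d\<close>
    divides \<open>4n\<close>, the conjugacy congruence then collapses to \<open>i = j\<close>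
    modulo \<open>d\<close>.\<close>
  have w: "[2*n - 1 = 1] (mod d)"
  proof (cases "odd n")
    case True
    then show ?thesis by (elim oddE) (simp add: d_def cong_def mod_simps)
  next
    case False
    then show ?thesis using assms by (simp add: d_def cong_def) presburger
  qed
  have "d dvd 4*n" by (auto simp: d_def)
  then have "[t + (2*n-1)^r * i = j + (2*n-1) * t] (mod d)" by (rule cong_dvd_modulus_nat[OF *])
  moreover have "[t + (2*n-1)^r * i = t + 1^r * i] (mod d)"
    by (intro cong_add cong_mult cong_pow w cong_refl)
  moreover have "[j + (2*n-1) * t = j + 1 * t] (mod d)"
    by (intro cong_add cong_mult w cong_refl)
  ultimately have "[t + 1 ^ r * i = j + 1 * t] (mod d)" by (metis cong_sym cong_trans)
  then have "[i = j] (mod d)"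
    by (simp add: add.commute[of t] cong_add_rcancel_nat)
  then show "i < 4*n \<and> j < 4*n \<and> [i = j] (mod (if odd n then 4 else 2))" using ij by (simp add: d_def)
next
  assume *: "i < 4*n \<and> j < 4*n \<and> [i = j] (mod (if odd n then 4 else 2))"
  \<comment> \<open>Conjugation by \<open>a^T\<close> sends \<open>a^i b\<close> to \<open>a^(i - (2n-2)T) b\<close>. For even n the congruence
    is solved by means of \<open>(n+1)^2 = 1 mod 2n\<close>.\<close>
  have "\<exists>T. int (4*n) dvd int j - int i + (2*int n - 2) * T"
  proof (cases "odd n")
    case True
    then have "[int j = int i] (mod 4)" using * by (metis cong_int_iff cong_sym of_nat_numeral)
    then obtain u where u: "int j - int i = 4 * u" unfolding cong_iff_dvd_diff by blast
    \<comment> \<open>The witness is \<open>T = 2u\<close>: \<open>(2n - 2) * 2\<close> is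
      \<open>-4\<close> modulo \<open>4n\<close>, which cancels \<open>4u\<close>.\<close>
    have "int j - int i + (2*int n - 2) * (2*u) = int (4*n) * u"
      unfolding u by (simp add: algebra_simps)
    then show ?thesis by (metis dvd_triv_left)
  next
    case False
    then have "[int j = int i] (mod 2)" using * by (metis cong_int_iff cong_sym of_nat_numeral)
    then obtain u where u: "int j - int i = 2 * u" unfolding cong_iff_dvd_diff by blast
    obtain h where h: "n = 2 * h" using False by blast
    have "int j - int i + (2*int n - 2) * ((int n + 1) * u) = int (4*n) * (u * int h)"
      unfolding u h by (simp add: algebra_simps)
    then show ?thesis by (metis dvd_triv_left)
  qed
  then obtain T where T: "int (4*n) dvd int j - int i + (2*int n - 2) * T" by blast
  \<comment> \<open>Exponents of group elements lie below \<open>4n\<close>, so the integer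
    \<open>T\<close> is replaced by its residue.\<close>
  define t where "t = nat (T mod int (4*n))"
  have t: "int t = T mod int (4*n)" "t < 4*n" using assms by (simp_all add: t_def nat_less_iff)
  have "[int (t + i) = T + int i] (mod int (4*n))" by (simp add: t cong_def mod_simps)
  also have "[T + int i = int j + (2*int n - 1) * T] (mod int (4*n))"
    using T unfolding cong_iff_dvd_diff by (subst dvd_minus_iff[symmetric]) (simp add: algebra_simps)
  also have "[int j + (2*int n - 1) * T = int j + (2*int n - 1) * int t] (mod int (4*n))"
    unfolding t by (intro cong_add cong_mult cong_refl) (simp add: cong_def)
  also have "int j + (2*int n - 1) * int t = int (j + (2*n - 1) * t)" using assms by (simp add: of_nat_diff)
  finally have "[t + i = j + (2*n - 1) * t] (mod (4*n))" unfolding cong_int_iff .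
  then have "\<exists>r<2. [t + (2*n - 1) ^ r * i = j + (2*n - 1) ^ 1 * t] (mod (4*n))"
    by (intro exI[of _ 0]) simp
  then show "conjugate (SD n) (i, 1) (j, 1)"
    using * t assms by (auto simp: conjugate_SD_iff)
qed

text \<open>Classes 0 and 1 are single central elements, conjugation keeps the exponent of
  \<open>b\<close>, and on reflections it keeps the exponent of \<open>a\<close> modulo 4 or 2,
  which is all that \<open>sd_class\<close> reads.\<close>

lemma sd_class_conjugate:
  assumes "n > 0" "conjugate (SD n) x y"
  shows "sd_class n x = sd_class n y"
proof -
  interpret group "SD n" using assms by (intro group_SD)
  obtain i p j q where xy: "x = (i, p)" "y = (j, q)" by fastforce
  then have qp: "q = p" and p: "p = 0 \<or> p = 1"
    using assms by (auto simp: conjugate_SD_iff)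
  show ?thesis
  proof (cases "p = 0")
    case True
    have "conjugate (SD n) (i, 0) (j, 0)" "conjugate (SD n) (j, 0) (i, 0)"
      using assms(2) conjugate_sym[OF assms(2)] True by (simp_all add: xy qp)
    then have "i = 0 \<or> i = 2*n \<Longrightarrow> j = i" "j = 0 \<or> j = 2*n \<Longrightarrow> i = j"
      using conjugate_SD_rotation_fixed[OF \<open>n > 0\<close>] by blast+
    then have "i = 0 \<longleftrightarrow> j = 0" "i = 2*n \<longleftrightarrow> j = 2*n" by blast+
    then show ?thesis using True by (simp add: xy qp sd_class_def)
  next
    case False
    then have ij: "[i = j] (mod (if odd n then 4 else 2))" and p: "p = 1"
      using p assms conjugate_SD_reflection_iff[of n i j] by (auto simp: xy qp)
    then have 4: "odd n \<Longrightarrow> i mod 4 = j mod 4" by (simp add: cong_def)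
    moreover have "i mod 2 = j mod 2"
    proof (cases "odd n")
      case True
      then have "i mod 4 mod 2 = j mod 4 mod 2" using 4 by simp
      then show ?thesis by (simp add: mod_mod_cancel)
    qed (use ij in \<open>simp add: cong_def\<close>)
    ultimately show ?thesis by (auto simp: xy qp p sd_class_def even_iff_mod_2_eq_zero)
  qed
qed

section \<open>Adjacency in terms of the classes\<close>

text \<open>The exponents \<open>i\<close> and \<open>(2n - 1) i\<close> add up to
  \<open>2n i\<close>. This separates the involutions \<open>a^i b\<close> from those of order
  4.\<close>

lemma square_SD_reflection:
  assumes "n > 0" shows "(i, Suc 0) \<otimes>\<^bsub>SD n\<^esub> (i, Suc 0) = (if odd i then 2*n else 0, 0)"
proof -
  have "i + (2*n - 1) * i = i * (2*n)" using assms by (cases n) (auto simp: algebra_simps)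
  then show ?thesis using assms odd_mult_half_cong[of i n]
    by (auto simp: mult_SD elim!: evenE)
qed

text \<open>By type of generator: rotations generate only rotations, an even reflection generates
  itself and \<open>e\<close>, and an odd reflection stays within classes 0, 1 and 3. Any two
  classes met by one such subgroup are adjacent.\<close>

lemma enh_adj_SD_class_adj:
  assumes "n > 0" "enh_adj (SD n) x y"
  shows "sd_class_adj (sd_class n x) (sd_class n y)"
proof -
  interpret group "SD n" using assms by (intro group_SD)
  obtain i p where z: "(i, p) \<in> carrier (SD n)"
    and xy: "x \<in> generate (SD n) {(i, p)}" "y \<in> generate (SD n) {(i, p)}"
    using assms unfolding enh_adj_def by (metis surj_pair)
  obtain j q where inv_z: "inv\<^bsub>SD n\<^esub> (i, p) = (j, q)" "(j, q) \<in> carrier (SD n)"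
    using z by (metis inv_closed surj_pair)
  have prod: "(i, p) \<otimes>\<^bsub>SD n\<^esub> (j, q) = (0, 0)" using r_inv[OF z] by (simp add: inv_z one_SD)
  consider "p = 0" | "p = 1" "even i" | "p = 1" "odd i"
    using z by (auto simp: carrier_SD less_2_cases_iff)
  then show ?thesis
  proof cases
    case 1
    have "generate (SD n) {(i, p)} \<subseteq> {x. snd x = 0}"
      using prod inv_z 1 by (intro generate_subset_of_closed) (auto simp: one_SD mult_SD carrier_SD)
    with xy have "snd x = 0" "snd y = 0" by auto
    then show ?thesis by (auto simp: sd_class_def sd_class_adj_def)
  next
    case 2
    then have sq: "(i, p) \<otimes>\<^bsub>SD n\<^esub> (i, p) = \<one>\<^bsub>SD n\<^esub>"
      using square_SD_reflection[OF \<open>n > 0\<close>, of i] by (simp add: one_SD)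
    then have "inv\<^bsub>SD n\<^esub> (i, p) = (i, p)" using z by (simp add: inv_equality)
    then have "generate (SD n) {(i, p)} \<subseteq> {\<one>\<^bsub>SD n\<^esub>, (i, p)}"
      using sq z by (intro generate_subset_of_closed) auto
    with xy have "x \<in> {\<one>\<^bsub>SD n\<^esub>, (i, p)}" "y \<in> {\<one>\<^bsub>SD n\<^esub>, (i, p)}" by blast+
    moreover have "sd_class n \<one>\<^bsub>SD n\<^esub> = 0" by (simp add: one_SD sd_class_def)
    ultimately show ?thesis unfolding sd_class_adj_def by fastforce
  next
    case 3
    \<comment> \<open>\<open>H\<close> is the cyclic group of order 4 generated by
      \<open>a^i b\<close>: \<open>u\<close> is 0 modulo \<open>2n\<close> for rotations and
      \<open>i\<close> modulo \<open>2n\<close> for reflections. Passing to modulus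
      \<open>2n\<close> turns the twist into -1, so closure becomes a computation with
      signs.\<close>
    define H where "H = {(u, q) \<in> carrier (SD n). [u = q * i] (mod (2*n))}"
    have w: "[int (2*n - 1) = -1] (mod int (2*n))"
    proof -
      have "int (2*n - 1) - (- 1) = int (2*n)" using assms by (simp add: of_nat_diff)
      then show ?thesis unfolding cong_iff_dvd_diff by (metis dvd_refl)
    qed
    have red: "[int (m mod (4*n)) = int m] (mod int (2*n))" for m
    proof -
      have "2*n dvd 4*n" by (rule dvdI[of _ _ 2]) simp
      then have "[m mod (4*n) = m] (mod (2*n))" unfolding cong_def by (rule mod_mod_cancel)
      then show ?thesis unfolding cong_int_iff .
    qed
    have mult: "[int (fst ((u, r) \<otimes>\<^bsub>SD n\<^esub> (v, s))) = int u + (-1) ^ r * int v] (mod int (2*n))" for u v r s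
    proof -
      have "[int (fst ((u, r) \<otimes>\<^bsub>SD n\<^esub> (v, s))) = int (u + (2*n - 1) ^ r * v)] (mod int (2*n))"
        unfolding mult_SD fst_conv by (rule red)
      also have "int (u + (2*n - 1) ^ r * v) = int u + int (2*n - 1) ^ r * int v" by simp
      also have "[\<dots> = int u + (-1) ^ r * int v] (mod int (2*n))"
        by (intro cong_add cong_mult cong_pow w cong_refl)
      finally show ?thesis .
    qed
    have H_iff: "(u, q) \<in> H \<longleftrightarrow> (u, q) \<in> carrier (SD n) \<and> [int u = int q * int i] (mod int (2*n))" for u q
      by (simp add: H_def flip: cong_int_iff)
    \<comment> \<open>The product with \<open>z\<close> has exponent 0 of \<open>b\<close>, so the
      inverse of the reflection \<open>z\<close> is a reflection.\<close>
    have "q = 1" using inv_z prod 3 by (auto simp: mult_SD carrier_SD less_2_cases_iff)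
    have "generate (SD n) {(i, p)} \<subseteq> H"
    proof (rule generate_subset_of_closed)
      have "[0 = int i - int j] (mod int (2*n))"
        using mult[of i 1 j q] prod 3 by simp
      then have "[int j = int i] (mod int (2*n))"
        by (simp add: cong_iff_dvd_diff dvd_diff_commute)
      then show "inv\<^bsub>SD n\<^esub> (i, p) \<in> H"
        using \<open>q = 1\<close> inv_z by (simp add: H_iff)
    next
      fix x y assume xy: "x \<in> H" "y \<in> H"
      obtain u r v s where uv: "x = (u, r)" "y = (v, s)" by fastforce
      have car: "x \<otimes>\<^bsub>SD n\<^esub> y \<in> carrier (SD n)" using xy uv by (auto simp: H_iff)
      have *: "[int u = int r * int i] (mod int (2*n))" "[int v = int s * int i] (mod int (2*n))"
        and rs: "r < 2" "s < 2"
        using xy by (auto simp: uv H_iff carrier_SD)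
      have "[int (fst (x \<otimes>\<^bsub>SD n\<^esub> y)) = int u + (-1) ^ r * int v] (mod int (2*n))"
        unfolding uv by (rule mult)
      also have "[int u + (-1) ^ r * int v = int r * int i + (-1) ^ r * (int s * int i)] (mod int (2*n))"
        by (intro cong_add cong_mult * cong_refl)
      \<comment> \<open>Only \<open>r = s = 1\<close> involves cancellation, namely
        \<open>i - i = 0\<close>.\<close>
      also have "int r * int i + (-1) ^ r * (int s * int i) = int ((r + s) mod 2) * int i"
        using rs by (auto simp: less_2_cases_iff)
      finally show "x \<otimes>\<^bsub>SD n\<^esub> y \<in> H"
        using car unfolding H_def uv mult_SD by (simp flip: cong_int_iff)
    qed (use 3 z assms in \<open>auto simp: one_SD H_iff carrier_SD\<close>)
    have H_class: "sd_class n (u, q) \<in> {0, 1, 3}" if "(u, q) \<in> H" for u q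
    proof -
      have u: "u < 4*n" "q = 0 \<or> q = 1" "[u = q * i] (mod 2*n)"
        using that by (auto simp: H_def carrier_SD)
      show ?thesis
      proof (cases "q = 0")
        case True
        then obtain c where c: "u = 2*n*c" using u by (auto simp: cong_0_iff)
        then have "c < 2" using u by simp
        then show ?thesis using True c by (auto simp: sd_class_def less_2_cases_iff)
      next
        case False
        then have "[u = i] (mod 2)" using u cong_dvd_modulus_nat[of u i "2*n" 2] by simp
        then have "odd u" using 3 by (simp add: cong_def odd_iff_mod_2_eq_one)
        then show ?thesis using False by (simp add: sd_class_def)
      qed
    qed
    have "sd_class n x \<in> {0, 1, 3}" "sd_class n y \<in> {0, 1, 3}"
      using xy \<open>generate _ _ \<subseteq> H\<close> H_class by (metis subsetD surj_pair)+
    then show ?thesis by (auto simp: sd_class_adj_def)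
  qed
qed

lemma rotation_in_generate:
  assumes "n > 0" "i < 4*n"
  shows "(i, 0) \<in> generate (SD n) {(1, 0)}"
  using \<open>i < 4*n\<close>
proof (induction i)
  case 0
  then show ?case using generate.one[of "SD n"] by (simp add: one_SD)
next
  case (Suc i)
  then have "(1, 0) \<otimes>\<^bsub>SD n\<^esub> (i, 0) \<in> generate (SD n) {(1, 0)}"
    by (intro generate.eng) (auto intro: generate.incl)
  then show ?case using Suc by (simp add: mult_SD)
qed

text \<open>Such a pair lies in a common cyclic subgroup or is conjugate, except for some odd
  reflections with \<open>n\<close> odd, where one of the two is first replaced by a conjugate. The
  order on the classes halves the cases.\<close>

lemma class_adj_imp_conj_super_enh_adj_SD:
  assumes n: "n > 0" and x: "x \<in> carrier (SD n)" and y: "y \<in> carrier (SD n)" and ne: "x \<noteq> y"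
    and adj: "sd_class_adj (sd_class n x) (sd_class n y)"
    and le: "sd_class n x \<le> sd_class n y"
  shows "conj_super_enh_adj (SD n) x y"
proof -
  interpret group "SD n" using n by (rule group_SD)
  have common: "conj_super_enh_adj (SD n) x y"
    if "x \<in> generate (SD n) {z}" "y \<in> generate (SD n) {z}" "z \<in> carrier (SD n)" for z
    using that x y ne by (intro enh_adj_imp_conj_super_enh_adj) (unfold enh_adj_def, blast)
  obtain i p j q where xy: "x = (i, p)" "y = (j, q)" by fastforce
  have bounds: "i < 4*n" "j < 4*n" "p = 0 \<or> p = 1" "q = 0 \<or> q = 1"
    using x y by (auto simp: xy carrier_SD)
  have conj: "conj_super_enh_adj (SD n) x y" if "conjugate (SD n) x y"
    using that x y ne by (simp add: conj_super_enh_adj_def)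
  consider "x = (0, 0)" | "p = 0" "q = 0" | "x = (2*n, 0)" "q = 1" "odd j"
    | "p = 1" "q = 1" "odd i" "odd j" | "p = 1" "q = 1" "[i = j] (mod (if odd n then 4 else 2))"
  proof -
    \<comment> \<open>For odd \<open>n\<close> the split between classes 4 and 5 records the residue
      modulo 4 of an even exponent; for even \<open>n\<close> parity suffices.\<close>
    have par: "[i = j] (mod (if odd n then 4 else 2))"
      if "even i" "even j" "odd n \<Longrightarrow> i mod 4 = 2 \<longleftrightarrow> j mod 4 = 2"
      using that by (auto simp: cong_def) presburger+
    show thesis if *: "x = (0, 0) \<Longrightarrow> thesis" "p = 0 \<Longrightarrow> q = 0 \<Longrightarrow> thesis"
      "x = (2*n, 0) \<Longrightarrow> q = 1 \<Longrightarrow> odd j \<Longrightarrow> thesis"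
      "p = 1 \<Longrightarrow> q = 1 \<Longrightarrow> odd i \<Longrightarrow> odd j \<Longrightarrow> thesis"
      "p = 1 \<Longrightarrow> q = 1 \<Longrightarrow> [i = j] (mod (if odd n then 4 else 2)) \<Longrightarrow> thesis"
    proof (cases "p = 1 \<and> q = 1")
      case True
      then show thesis
        using adj *(4,5) par by (auto simp: xy sd_class_def sd_class_adj_def split: if_splits)
    next
      case False
      then show thesis
        using adj le bounds *(1-3) by (auto simp: xy sd_class_def sd_class_adj_def split: if_splits)
    qed
  qed
  moreover have "1 < 4*n" using n by linarith
  ultimately show ?thesis
  proof cases
    case 1
    then show ?thesis
      using y by (intro common[of y]) (auto simp flip: one_SD[of n] intro: generate.intros)
  next
    case 2
    then show ?thesis
      using rotation_in_generate[OF n] bounds n \<open>1 < 4*n\<close>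
      by (intro common[of "(1, 0)"]) (auto simp: xy carrier_SD)
  next
    case 3
    \<comment> \<open>The central involution is the square of \<open>y\<close>, so the subgroup
      generated by \<open>y\<close> contains both.\<close>
    then have "x = y \<otimes>\<^bsub>SD n\<^esub> y" using square_SD_reflection[OF n] by (simp add: xy)
    moreover have "y \<otimes>\<^bsub>SD n\<^esub> y \<in> generate (SD n) {y}"
      by (intro generate.intros) auto
    ultimately show ?thesis
      using y by (intro common[of y]) (auto intro: generate.incl)
  next
    case 4
    show ?thesis
    proof (cases "[i = j] (mod (if odd n then 4 else 2))")
      case True
      then show ?thesis using conj 4 bounds n by (simp add: xy conjugate_SD_reflection_iff[simplified])
    next
      case False
      have "odd n" using False 4 by (auto simp: cong_def odd_iff_mod_2_eq_one split: if_splits)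
      \<comment> \<open>For odd n the two conjugacy classes of odd reflections are joined by x and its inverse.\<close>
      define y' where "y' = ((i + 2*n) mod (4*n), Suc 0)"
      have "y' = x \<otimes>\<^bsub>SD n\<^esub> (x \<otimes>\<^bsub>SD n\<^esub> x)"
      proof -
        have "x \<otimes>\<^bsub>SD n\<^esub> x = (2*n, 0)" using square_SD_reflection[OF n] 4 by (simp add: xy)
        moreover have "[i + (2*n - 1) * (2*n) = i + 2*n] (mod 4*n)"
          using odd_mult_half_cong[of "2*n - 1" n] n by (intro cong_add) (auto simp: cong_def)
        ultimately show ?thesis using 4 by (simp add: y'_def xy mult_SD cong_def)
      qed
      moreover have "x \<otimes>\<^bsub>SD n\<^esub> (x \<otimes>\<^bsub>SD n\<^esub> x) \<in> generate (SD n) {x}"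
        by (intro generate.intros) auto
      ultimately have gen: "y' \<in> generate (SD n) {x}" by simp
      have ne': "x \<noteq> y'" using bounds n by (auto simp: xy y'_def mod_if)
      have y': "y' \<in> carrier (SD n)" using n by (simp add: y'_def carrier_SD)
      have "enh_adj (SD n) x y'"
        using gen ne' x y' by (auto simp: enh_adj_def intro!: bexI[of _ x] generate.incl)
      moreover have "[j = (i + 2*n) mod (4*n)] (mod 4)"
      proof -
        have "(i + 2*n) mod (4*n) mod 4 = (i + 2*n) mod 4" by (simp add: mod_mod_cancel)
        \<comment> \<open>For odd \<open>n\<close>, adding \<open>2n\<close> exchanges the residues
          1 and 3 modulo 4, and \<open>i\<close> and \<open>j\<close> have different ones.\<close>
        moreover have "(i + 2*n) mod 4 = j mod 4"
        proof -
          have "i mod 4 \<noteq> j mod 4" using \<open>odd n\<close> False by (simp add: cong_def)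
          moreover have "i mod 4 = 1 \<or> i mod 4 = 3" "j mod 4 = 1 \<or> j mod 4 = 3"
            using \<open>odd i\<close> \<open>odd j\<close> by presburger+
          moreover have "2*n mod 4 = 2" using \<open>odd n\<close> by presburger
          ultimately show ?thesis by (auto simp flip: mod_add_eq[of i 4 "2*n"])
        qed
        ultimately show ?thesis by (simp add: cong_def)
      qed
      then have "conjugate (SD n) y y'"
        using \<open>odd n\<close> bounds n 4 conjugate_SD_reflection_iff[OF n, of j "(i + 2*n) mod (4*n)"]
        by (simp add: xy y'_def)
      ultimately show ?thesis
        using x y ne conjugate_refl[OF x] unfolding conj_super_enh_adj_def by blast
    qed
  next
    case 5
    then show ?thesis using conj bounds n by (simp add: xy conjugate_SD_reflection_iff[simplified])
  qed
qed

text \<open>Passing to conjugates leaves classes unchanged, which gives the forward direction. For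
  the converse, symmetry of the graph arranges the order of the classes.\<close>

lemma conj_super_enh_adj_SD_iff:
  assumes n: "n > 0" and x: "x \<in> carrier (SD n)" and y: "y \<in> carrier (SD n)"
  shows "conj_super_enh_adj (SD n) x y \<longleftrightarrow> x \<noteq> y \<and> sd_class_adj (sd_class n x) (sd_class n y)"
proof -
  interpret group "SD n" using n by (rule group_SD)
  have sym: "sd_class_adj p q \<Longrightarrow> sd_class_adj q p" for p q by (auto simp: sd_class_adj_def)
  show ?thesis
  proof
    assume "conj_super_enh_adj (SD n) x y"
    then show "x \<noteq> y \<and> sd_class_adj (sd_class n x) (sd_class n y)"
      unfolding conj_super_enh_adj_def
      using enh_adj_SD_class_adj[OF n] sd_class_conjugate[OF n] by (metis sd_class_adj_def)
  next
    assume "x \<noteq> y \<and> sd_class_adj (sd_class n x) (sd_class n y)"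
    then show "conj_super_enh_adj (SD n) x y"
      using class_adj_imp_conj_super_enh_adj_SD[OF n x y] class_adj_imp_conj_super_enh_adj_SD[OF n y x]
        conj_super_enh_adj_sym sym by (metis nle_le)
  qed
qed

section \<open>Sizes of the classes\<close>

lemma sd_class_eq_iff:
  assumes "n > 0"
  shows "sd_class n (i, p) = 0 \<longleftrightarrow> p = 0 \<and> i = 0"
    and "sd_class n (i, p) = Suc 0 \<longleftrightarrow> p = 0 \<and> i = 2*n"
    and "sd_class n (i, p) = 2 \<longleftrightarrow> p = 0 \<and> i \<noteq> 0 \<and> i \<noteq> 2*n"
    and "sd_class n (i, p) = 3 \<longleftrightarrow> p \<noteq> 0 \<and> odd i"
    and "sd_class n (i, p) = 4 \<longleftrightarrow> p \<noteq> 0 \<and> even i \<and> \<not> (odd n \<and> i mod 4 = 2)"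
    and "sd_class n (i, p) = 5 \<longleftrightarrow> p \<noteq> 0 \<and> even i \<and> odd n \<and> i mod 4 = 2"
  using assms by (simp_all add: sd_class_def)

text \<open>The solutions of \<open>i mod a = b\<close> below \<open>4n\<close> are
  \<open>a * k + b\<close> with \<open>k < m\<close>. Here \<open>a\<close> is a modulus: 2 for
  class 3 and for class 4 with \<open>n\<close> even, 4 for classes 4 and 5 with \<open>n\<close>
  odd.\<close>

lemma card_reflections_mod:
  fixes a b m n :: nat
  assumes "b < a" and "a * m = 4*n"
    and "\<And>i p. i < 4*n \<Longrightarrow> p < 2 \<Longrightarrow> P (i, p) \<longleftrightarrow> p \<noteq> 0 \<and> i mod a = b"
  shows "card {v \<in> carrier (SD n). P v} = m"
proof -
  have "bij_betw (\<lambda>k. (a * k + b, 1)) {..<m} {v \<in> carrier (SD n). P v}"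
  proof (rule bij_betwI[where g = "\<lambda>v. fst v div a"])
    have "a * k + b < 4*n" if "k < m" for k
    proof -
      have "a * k + b < a * Suc k" using \<open>b < a\<close> by simp
      also have "\<dots> \<le> a * m" using that by (intro mult_le_mono2) simp
      finally show ?thesis using assms(2) by simp
    qed
    then show "(\<lambda>k. (a * k + b, 1)) \<in> {..<m} \<rightarrow> {v \<in> carrier (SD n). P v}"
      using assms by (auto simp: carrier_SD)
    have "i div a < m" if "i < 4*n" for i
      using that unfolding assms(2)[symmetric] by (simp add: less_mult_imp_div_less mult.commute)
    then show "(\<lambda>v. fst v div a) \<in> {v \<in> carrier (SD n). P v} \<rightarrow> {..<m}"
      by (auto simp: carrier_SD)
    show "(a * (fst v div a) + b, 1) = v" if "v \<in> {v \<in> carrier (SD n). P v}" for v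
    proof -
      have "fst v mod a = b" "snd v = 1"
        using that assms(3)[of "fst v" "snd v"] by (auto simp: carrier_SD)
      then show ?thesis using mult_div_mod_eq[of a "fst v"] by (intro prod_eqI) simp_all
    qed
  qed (use \<open>b < a\<close> in auto)
  then show ?thesis by (simp add: bij_betw_same_card[symmetric])
qed

lemma card_sd_class:
  assumes n: "n > 0"
  shows "card {v \<in> carrier (SD n). sd_class n v = 0} = 1"
    and "card {v \<in> carrier (SD n). sd_class n v = Suc 0} = 1"
    and "card {v \<in> carrier (SD n). sd_class n v = 2} = 4*n - 2"
    and "card {v \<in> carrier (SD n). sd_class n v = 3} = 2*n"
    and "card {v \<in> carrier (SD n). sd_class n v = 4} = (if odd n then n else 2*n)"
    and "odd n \<Longrightarrow> card {v \<in> carrier (SD n). sd_class n v = 5} = n"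
proof -
  have "{v \<in> carrier (SD n). sd_class n v = 0} = {(0, 0)}"
    using n unfolding carrier_SD by (auto simp: sd_class_eq_iff)
  then show "card {v \<in> carrier (SD n). sd_class n v = 0} = 1" by simp
  have "{v \<in> carrier (SD n). sd_class n v = Suc 0} = {(2*n, 0)}"
    using n unfolding carrier_SD by (auto simp: sd_class_eq_iff)
  then show "card {v \<in> carrier (SD n). sd_class n v = Suc 0} = 1" by simp
  have "{v \<in> carrier (SD n). sd_class n v = 2} = ({..<4*n} - {0, 2*n}) \<times> {0}"
    using n unfolding carrier_SD by (auto simp: sd_class_eq_iff)
  then show "card {v \<in> carrier (SD n). sd_class n v = 2} = 4*n - 2"
    using n by (simp add: card_cartesian_product card_Diff_subset)
  show "card {v \<in> carrier (SD n). sd_class n v = 3} = 2*n"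
    by (rule card_reflections_mod[of 1 2]) (use n in \<open>auto simp: sd_class_eq_iff odd_iff_mod_2_eq_one\<close>)
  show "card {v \<in> carrier (SD n). sd_class n v = 5} = n" if "odd n"
  proof (rule card_reflections_mod[of 2 4])
    have "i mod 4 = 2 \<Longrightarrow> even i" for i :: nat by presburger
    then show "sd_class n (i, p) = 5 \<longleftrightarrow> p \<noteq> 0 \<and> i mod 4 = 2" for i p
      using n that by (auto simp: sd_class_eq_iff)
  qed auto
  show "card {v \<in> carrier (SD n). sd_class n v = 4} = (if odd n then n else 2*n)"
  proof (cases "odd n")
    case True
    have "card {v \<in> carrier (SD n). sd_class n v = 4} = n"
    proof (rule card_reflections_mod[of 0 4])
      have "even i \<and> i mod 4 \<noteq> 2 \<longleftrightarrow> i mod 4 = 0" for i :: nat by presburger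
      then show "sd_class n (i, p) = 4 \<longleftrightarrow> p \<noteq> 0 \<and> i mod 4 = 0" for i p
        using n True by (simp add: sd_class_eq_iff)
    qed auto
    then show ?thesis using True by simp
  next
    case False
    have "card {v \<in> carrier (SD n). sd_class n v = 4} = 2*n"
      by (rule card_reflections_mod[of 0 2])
        (use n False in \<open>auto simp: sd_class_eq_iff even_iff_mod_2_eq_zero\<close>)
    then show ?thesis using False by simp
  qed
qed

lemma sd_class_less:
  shows "sd_class n v < 6" and "even n \<Longrightarrow> sd_class n v < 5"
  by (simp_all add: sd_class_def)

lemma sd_class_adj_refl: "sd_class_adj p p"
  by (simp add: sd_class_adj_def)

section \<open>The spectrum for odd and for even n\<close>

text \<open>Sizes \<open>m\<close> and degrees \<open>d\<close> stay parameters, so that one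
  statement serves six classes for odd \<open>n\<close> and five for even \<open>n\<close>.\<close>

lemma sombor_spectrum_SD_classes:
  assumes n: "n > 0"
    and k: "\<And>v. sd_class n v < k"
    and m: "\<And>p. p < k \<Longrightarrow> card {v \<in> carrier (SD n). sd_class n v = p} = m p"
    and m_pos: "\<And>p. p < k \<Longrightarrow> m p > 0"
    and d: "\<And>p. p < k \<Longrightarrow> d p = real ((\<Sum>q<k. if sd_class_adj p q then m q else 0) - 1)"
  shows "sombor_spectrum (carrier (SD n)) (conj_super_enh_adj (SD n)) =
    (\<Sum>p<k. replicate_mset (m p - 1) (complex_of_real (- d p * sqrt 2))) +
    mat_spectrum (mat k k (\<lambda>(p, q).
      real (m q) * (if sd_class_adj p q then sqrt (d p ^ 2 + d q ^ 2) else 0)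
        - (if p = q then d p * sqrt 2 else 0)))"
proof (rule sombor_spectrum_equitable[OF _ k m m_pos conj_super_enh_adj_SD_iff[OF n] sd_class_adj_refl d])
  show "finite (carrier (SD n))" by (simp add: carrier_SD)
qed

lemma sombor_spectrum_SD_odd:
  assumes n: "n \<ge> 2" and par: "odd n"
  shows "sombor_spectrum (carrier (SD n)) (conj_super_enh_adj (SD n)) =
        replicate_mset (2*n - 1) (complex_of_real (- (2 * real n + 1) * sqrt 2)) +
        replicate_mset (4*n - 3) (complex_of_real (- (4 * real n - 1) * sqrt 2)) +
        replicate_mset (2*n - 2) (complex_of_real (- real n * sqrt 2)) +
        mat_spectrum (Q_odd n)"
proof -
  \<comment> \<open>Sizes and degrees in the order of \<open>sd_class\<close>; the degrees are
    \<alpha>, \<beta>, \<gamma>, \<delta>, \<psi>, \<psi>.\<close>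
  define m where "m p = [1, 1, 4*n - 2, 2*n, n, n] ! p" for p
  define d where "d p = [8 * real n - 1, 6 * real n - 1, 4 * real n - 1, 2 * real n + 1, real n, real n] ! p" for p
  have m_simps: "m 0 = 1" "m (Suc 0) = 1" "m 2 = 4*n - 2" "m 3 = 2*n" "m 4 = n" "m 5 = n"
    by (simp_all add: m_def)
  have d_simps: "d 0 = 8 * real n - 1" "d (Suc 0) = 6 * real n - 1" "d 2 = 4 * real n - 1"
      "d 3 = 2 * real n + 1" "d 4 = real n" "d 5 = real n"
    by (simp_all add: d_def)
  have sum_eq: "(\<Sum>p<6. f p) = f 0 + f (Suc 0) + f 2 + f 3 + f 4 + f 5" for f :: "nat \<Rightarrow> 'b :: comm_monoid_add"
    by (simp add: eval_nat_numeral ac_simps)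
  have less_eq: "p < 6 \<longleftrightarrow> p = 0 \<or> p = Suc 0 \<or> p = 2 \<or> p = 3 \<or> p = 4 \<or> p = 5" for p :: nat
    by presburger
  have "sombor_spectrum (carrier (SD n)) (conj_super_enh_adj (SD n)) =
    (\<Sum>p<6. replicate_mset (m p - 1) (complex_of_real (- d p * sqrt 2))) +
    mat_spectrum (mat 6 6 (\<lambda>(p, q).
      real (m q) * (if sd_class_adj p q then sqrt (d p ^ 2 + d q ^ 2) else 0)
        - (if p = q then d p * sqrt 2 else 0)))"
  proof (rule sombor_spectrum_SD_classes)
    show "n > 0" using n by simp
    show "sd_class n v < 6" for v using par by (simp add: sd_class_less)
    fix p :: nat assume "p < 6"
    then consider "p = 0" | "p = Suc 0" | "p = 2" | "p = 3" | "p = 4" | "p = 5"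
      unfolding less_eq by blast
    note cases = this
    show "card {v \<in> carrier (SD n). sd_class n v = p} = m p"
      using cases n par by cases (simp_all add: card_sd_class m_simps)
    show "m p > 0"
      using cases n by cases (simp_all add: m_simps)
    \<comment> \<open>These are sizes of closed neighbourhoods, hence one more than the degrees in
      \<open>d\<close>.\<close>
    have deg: "(\<Sum>q<6. if sd_class_adj p q then m q else 0) = [8*n, 6*n, 4*n, 2*n + 2, n + 1, n + 1] ! p"
      using cases n unfolding sum_eq m_simps by cases (simp_all add: sd_class_adj_def)
    show "d p = real ((\<Sum>q<6. if sd_class_adj p q then m q else 0) - 1)"
      using cases n unfolding deg by cases (simp_all add: d_def of_nat_diff)
  qed
  also have "mat 6 6 (\<lambda>(p, q).
      real (m q) * (if sd_class_adj p q then sqrt (d p ^ 2 + d q ^ 2) else 0)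
        - (if p = q then d p * sqrt 2 else 0)) = Q_odd n"
  proof (rule eq_matI, goal_cases)
    case (1 p q)
    then have p: "p < 6" and q: "q < 6" by (simp_all add: Q_odd_def mat_of_rows_list_def Let_def)
    have m: "real (m j) = [1, 1, 4 * real n - 2, 2 * real n, real n, real n] ! j" if "j < 6" for j
      using that n unfolding less_eq by (auto simp: m_def of_nat_diff)
    show ?case
    proof (cases "p = q")
      case True
      have diag: "Q_odd n $$ (p, p) = [0, 0, (4 * real n - 3) * (4 * real n - 1) * sqrt 2, (2 * real n - 1) * (2 * real n + 1) * sqrt 2, (real n - 1) * real n * sqrt 2, (real n - 1) * real n * sqrt 2] ! p"
        using p unfolding less_eq
        by (elim disjE) (simp_all add: Q_odd_def mat_of_rows_list_def Let_def)
      \<comment> \<open>Nonnegativity turns \<open>sqrt (d p ^ 2 + d p ^ 2)\<close> into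
        \<open>d p * sqrt 2\<close>; the correction for the zero diagonal then lowers the factor
        \<open>m p\<close> to \<open>m p - 1\<close>.\<close>
      have "d p \<ge> 0" using p n unfolding less_eq by (elim disjE) (simp_all add: d_simps)
      then have "mat 6 6 (\<lambda>(p, q).
          real (m q) * (if sd_class_adj p q then sqrt (d p ^ 2 + d q ^ 2) else 0)
            - (if p = q then d p * sqrt 2 else 0)) $$ (p, p) = (real (m p) - 1) * d p * sqrt 2"
        using p by (simp add: sd_class_adj_refl real_sqrt_mult algebra_simps)
      also have "\<dots> = [0, 0, (4 * real n - 3) * (4 * real n - 1) * sqrt 2, (2 * real n - 1) * (2 * real n + 1) * sqrt 2, (real n - 1) * real n * sqrt 2, (real n - 1) * real n * sqrt 2] ! p"
        using p unfolding less_eq by (elim disjE) (simp_all add: m d_simps)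
      finally show ?thesis by (simp add: diag flip: True)
    next
      case False
      then show ?thesis using p q unfolding less_eq
        by (elim disjE) (simp_all add: m d_def sd_class_adj_def Q_odd_def mat_of_rows_list_def Let_def add.commute)
    qed
  qed (simp_all add: Q_odd_def mat_of_rows_list_def Let_def)
  also have "(\<Sum>p<6. replicate_mset (m p - 1) (complex_of_real (- d p * sqrt 2))) =
        replicate_mset (2*n - 1) (complex_of_real (- (2 * real n + 1) * sqrt 2)) +
        replicate_mset (4*n - 3) (complex_of_real (- (4 * real n - 1) * sqrt 2)) +
        replicate_mset (2*n - 2) (complex_of_real (- real n * sqrt 2))"
  proof -
    \<comment> \<open>Classes 4 and 5 have equal size and degree, and each contributes
      \<open>n - 1\<close> copies of the same eigenvalue.\<close>
    have "replicate_mset (2*n - 2) x = replicate_mset (n - 1) x + replicate_mset (n - 1) x" for x :: complex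
      by (rule multiset_eqI) auto
    then show ?thesis unfolding sum_eq m_simps d_simps by (simp add: ac_simps numeral_3_eq_3)
  qed
  finally show ?thesis .
qed

lemma sombor_spectrum_SD_even:
  assumes n: "n \<ge> 2" and par: "even n"
  shows "sombor_spectrum (carrier (SD n)) (conj_super_enh_adj (SD n)) =
        replicate_mset (4*n - 3) (complex_of_real (- (4 * real n - 1) * sqrt 2)) +
        replicate_mset (2*n - 1) (complex_of_real (- (2 * real n + 1) * sqrt 2)) +
        replicate_mset (2*n - 1) (complex_of_real (- (2 * real n) * sqrt 2)) +
        mat_spectrum (Q_even n)"
proof -
  \<comment> \<open>For even \<open>n\<close> the involutions \<open>a^i b\<close> form a single
    class of size \<open>2n\<close>, with degree \<psi> equal to \<open>2n\<close>.\<close>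
  define m where "m p = [1, 1, 4*n - 2, 2*n, 2*n] ! p" for p
  define d where "d p = [8 * real n - 1, 6 * real n - 1, 4 * real n - 1, 2 * real n + 1, 2 * real n] ! p" for p
  have m_simps: "m 0 = 1" "m (Suc 0) = 1" "m 2 = 4*n - 2" "m 3 = 2*n" "m 4 = 2*n"
    by (simp_all add: m_def)
  have d_simps: "d 0 = 8 * real n - 1" "d (Suc 0) = 6 * real n - 1" "d 2 = 4 * real n - 1"
      "d 3 = 2 * real n + 1" "d 4 = 2 * real n"
    by (simp_all add: d_def)
  have sum_eq: "(\<Sum>p<5. f p) = f 0 + f (Suc 0) + f 2 + f 3 + f 4" for f :: "nat \<Rightarrow> 'b :: comm_monoid_add"
    by (simp add: eval_nat_numeral ac_simps)
  have less_eq: "p < 5 \<longleftrightarrow> p = 0 \<or> p = Suc 0 \<or> p = 2 \<or> p = 3 \<or> p = 4" for p :: nat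
    by presburger
  have "sombor_spectrum (carrier (SD n)) (conj_super_enh_adj (SD n)) =
    (\<Sum>p<5. replicate_mset (m p - 1) (complex_of_real (- d p * sqrt 2))) +
    mat_spectrum (mat 5 5 (\<lambda>(p, q).
      real (m q) * (if sd_class_adj p q then sqrt (d p ^ 2 + d q ^ 2) else 0)
        - (if p = q then d p * sqrt 2 else 0)))"
  proof (rule sombor_spectrum_SD_classes)
    show "n > 0" using n by simp
    show "sd_class n v < 5" for v using par by (simp add: sd_class_less)
    fix p :: nat assume "p < 5"
    then consider "p = 0" | "p = Suc 0" | "p = 2" | "p = 3" | "p = 4"
      unfolding less_eq by blast
    note cases = this
    show "card {v \<in> carrier (SD n). sd_class n v = p} = m p"
      using cases n par by cases (simp_all add: card_sd_class m_simps)
    show "m p > 0"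
      using cases n by cases (simp_all add: m_simps)
    have deg: "(\<Sum>q<5. if sd_class_adj p q then m q else 0) = [8*n, 6*n, 4*n, 2*n + 2, 2*n + 1] ! p"
      using cases n unfolding sum_eq m_simps by cases (simp_all add: sd_class_adj_def)
    show "d p = real ((\<Sum>q<5. if sd_class_adj p q then m q else 0) - 1)"
      using cases n unfolding deg by cases (simp_all add: d_def of_nat_diff)
  qed
  also have "mat 5 5 (\<lambda>(p, q).
      real (m q) * (if sd_class_adj p q then sqrt (d p ^ 2 + d q ^ 2) else 0)
        - (if p = q then d p * sqrt 2 else 0)) = Q_even n"
  proof (rule eq_matI, goal_cases)
    case (1 p q)
    then have p: "p < 5" and q: "q < 5" by (simp_all add: Q_even_def mat_of_rows_list_def Let_def)
    have m: "real (m j) = [1, 1, 4 * real n - 2, 2 * real n, 2 * real n] ! j" if "j < 5" for j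
      using that n unfolding less_eq by (auto simp: m_def of_nat_diff)
    show ?case
    proof (cases "p = q")
      case True
      have diag: "Q_even n $$ (p, p) = [0, 0, (4 * real n - 3) * (4 * real n - 1) * sqrt 2, (2 * real n - 1) * (2 * real n + 1) * sqrt 2, (2 * real n - 1) * (2 * real n) * sqrt 2] ! p"
        using p unfolding less_eq
        by (elim disjE) (simp_all add: Q_even_def mat_of_rows_list_def Let_def)
      have "d p \<ge> 0" using p n unfolding less_eq by (elim disjE) (simp_all add: d_simps)
      then have "mat 5 5 (\<lambda>(p, q).
          real (m q) * (if sd_class_adj p q then sqrt (d p ^ 2 + d q ^ 2) else 0)
            - (if p = q then d p * sqrt 2 else 0)) $$ (p, p) = (real (m p) - 1) * d p * sqrt 2"
        using p by (simp add: sd_class_adj_refl real_sqrt_mult algebra_simps)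
      also have "\<dots> = [0, 0, (4 * real n - 3) * (4 * real n - 1) * sqrt 2, (2 * real n - 1) * (2 * real n + 1) * sqrt 2, (2 * real n - 1) * (2 * real n) * sqrt 2] ! p"
        using p unfolding less_eq by (elim disjE) (simp_all add: m d_simps)
      finally show ?thesis by (simp add: diag flip: True)
    next
      case False
      then show ?thesis using p q unfolding less_eq
        by (elim disjE) (simp_all add: m d_def sd_class_adj_def Q_even_def mat_of_rows_list_def Let_def add.commute)
    qed
  qed (simp_all add: Q_even_def mat_of_rows_list_def Let_def)
  also have "(\<Sum>p<5. replicate_mset (m p - 1) (complex_of_real (- d p * sqrt 2))) =
        replicate_mset (4*n - 3) (complex_of_real (- (4 * real n - 1) * sqrt 2)) +
        replicate_mset (2*n - 1) (complex_of_real (- (2 * real n + 1) * sqrt 2)) +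
        replicate_mset (2*n - 1) (complex_of_real (- (2 * real n) * sqrt 2))"
    unfolding sum_eq m_simps d_simps by (simp add: ac_simps numeral_3_eq_3)
  finally show ?thesis .
qed

theorem theorem5p8:
  fixes n :: nat
  assumes "n \<ge> 2"
  shows "(odd n \<longrightarrow>
      sombor_spectrum (carrier (SD n)) (conj_super_enh_adj (SD n)) =
        replicate_mset (2*n - 1) (complex_of_real (- (2 * real n + 1) * sqrt 2)) +
        replicate_mset (4*n - 3) (complex_of_real (- (4 * real n - 1) * sqrt 2)) +
        replicate_mset (2*n - 2) (complex_of_real (- real n * sqrt 2)) +
        mat_spectrum (Q_odd n))
    \<and> (even n \<longrightarrow>
      sombor_spectrum (carrier (SD n)) (conj_super_enh_adj (SD n)) =
        replicate_mset (4*n - 3) (complex_of_real (- (4 * real n - 1) * sqrt 2)) +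
        replicate_mset (2*n - 1) (complex_of_real (- (2 * real n + 1) * sqrt 2)) +
        replicate_mset (2*n - 1) (complex_of_real (- (2 * real n) * sqrt 2)) +
        mat_spectrum (Q_even n))"
  using sombor_spectrum_SD_odd[OF assms] sombor_spectrum_SD_even[OF assms] by blast

end
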